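(* Let $d\ge 3$ be an integer, and let $G$ be a (simple, possibly infinite) connected graph which is weakly $3$-locally $\mathbb{L}^d$. Then there exists a normal covering map from $\mathbb{L}^d$ to $G$.
   Context: $\mathbb{L}^d$ is the graph with vertex set $\mathbb{Z}^d$ and edges $\{x,x+e_i\}$ for $x\in\mathbb{Z}^d$, $i\in\{1,\dots,d\}$. For a graph $G$ and vertex $v$, $\mathrm{Link}^-_r(v,G)$ is the subgraph of $G$ consisting of all vertices at graph distance at most $r$ from $v$ and all edges $xy$ with $\min\{d_G(v,x),d_G(v,y)\}<r$. $G$ is weakly $r$-locally $\mathbb{L}^d$ if for every vertex $v$ of $G$ there is a graph isomorphism $\phi:\mathrm{Link}^-_r(0,\mathbb{L}^d)\to \mathrm{Link}^-_r(v,G)$ with $\phi(0)=v$. A covering map from $F$ to $G$ is a graph homomorphism $p:V(F)\to V(G)$ mapping the neighbour set of each $v$ bijectively onto that of $p(v)$; it is normal if the group of automorphisms $\phi$ of $F$ with $p\circ\phi=p$ acts transitively on each fibre of $p$. *)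

theory Defs
  imports Main "HOL-Library.Extended_Nat"
begin

record 'a sgraph =
  gverts :: "'a set"
  gedges :: "'a set set"

definition simple_graph :: "'a sgraph \<Rightarrow> bool" where
  "simple_graph G \<longleftrightarrow>
     (\<forall>e\<in>gedges G. \<exists>x\<in>gverts G. \<exists>y\<in>gverts G. x \<noteq> y \<and> e = {x, y})"

definition neighbours :: "'a sgraph \<Rightarrow> 'a \<Rightarrow> 'a set" where
  "neighbours G v = {w \<in> gverts G. {v, w} \<in> gedges G}"

definition gwalk :: "'a sgraph \<Rightarrow> 'a \<Rightarrow> 'a list \<Rightarrow> 'a \<Rightarrow> bool" where
  "gwalk G u xs v \<longleftrightarrow>
     xs \<noteq> [] \<and> set xs \<subseteq> gverts G \<and> hd xs = u \<and> last xs = v \<and>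
     successively (\<lambda>x y. {x, y} \<in> gedges G) xs"

text \<open>A walk is listed by its vertices, so its number of edges is one less than the
  length of the list. The infimum is \<open>\<infinity>\<close> if there is no walk.\<close>

definition gdist :: "'a sgraph \<Rightarrow> 'a \<Rightarrow> 'a \<Rightarrow> enat" where
  "gdist G u v = (INF xs\<in>{xs. gwalk G u xs v}. enat (length xs - 1))"

text \<open>The empty graph does not count as connected.\<close>

definition connected_graph :: "'a sgraph \<Rightarrow> bool" where
  "connected_graph G \<longleftrightarrow>
     gverts G \<noteq> {} \<and> (\<forall>u\<in>gverts G. \<forall>v\<in>gverts G. \<exists>xs. gwalk G u xs v)"

definition graph_hom :: "('a \<Rightarrow> 'b) \<Rightarrow> 'a sgraph \<Rightarrow> 'b sgraph \<Rightarrow> bool" where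
  "graph_hom f F G \<longleftrightarrow>
     f ` gverts F \<subseteq> gverts G \<and>
     (\<forall>x\<in>gverts F. \<forall>y\<in>gverts F. {x, y} \<in> gedges F \<longrightarrow> {f x, f y} \<in> gedges G)"

definition graph_iso :: "('a \<Rightarrow> 'b) \<Rightarrow> 'a sgraph \<Rightarrow> 'b sgraph \<Rightarrow> bool" where
  "graph_iso f F G \<longleftrightarrow>
     bij_betw f (gverts F) (gverts G) \<and>
     (\<forall>x\<in>gverts F. \<forall>y\<in>gverts F. {x, y} \<in> gedges F \<longleftrightarrow> {f x, f y} \<in> gedges G)"

text \<open>Points of \<open>\<int>\<^sup>d\<close> are functions on the naturals that vanish from index \<open>d\<close> on;
  the coordinates are numbered \<open>0, \<dots>, d - 1\<close>.\<close>

definition lattice_graph :: "nat \<Rightarrow> (nat \<Rightarrow> int) sgraph" where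
  "lattice_graph d =
     \<lparr> gverts = {x. \<forall>i\<ge>d. x i = 0},
       gedges = {{x, x(i := x i + 1)} | x i. (\<forall>j\<ge>d. x j = 0) \<and> i < d} \<rparr>"

definition link_minus :: "nat \<Rightarrow> 'a \<Rightarrow> 'a sgraph \<Rightarrow> 'a sgraph" where
  "link_minus r v G =
     \<lparr> gverts = {x \<in> gverts G. gdist G v x \<le> enat r},
       gedges = {{x, y} | x y. {x, y} \<in> gedges G \<and> min (gdist G v x) (gdist G v y) < enat r} \<rparr>"

definition weakly_locally_lattice :: "nat \<Rightarrow> nat \<Rightarrow> 'a sgraph \<Rightarrow> bool" where
  "weakly_locally_lattice r d G \<longleftrightarrow>
     (\<forall>v\<in>gverts G. \<exists>f.
        graph_iso f (link_minus r (\<lambda>_. 0) (lattice_graph d)) (link_minus r v G) \<and>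
        f (\<lambda>_. 0) = v)"

definition covering_map :: "('a \<Rightarrow> 'b) \<Rightarrow> 'a sgraph \<Rightarrow> 'b sgraph \<Rightarrow> bool" where
  "covering_map p F G \<longleftrightarrow>
     graph_hom p F G \<and>
     (\<forall>v\<in>gverts F. bij_betw p (neighbours F v) (neighbours G (p v)))"

definition deck_transformation :: "('a \<Rightarrow> 'b) \<Rightarrow> 'a sgraph \<Rightarrow> ('a \<Rightarrow> 'a) \<Rightarrow> bool" where
  "deck_transformation p F \<phi> \<longleftrightarrow> graph_iso \<phi> F F \<and> (\<forall>x\<in>gverts F. p (\<phi> x) = p x)"

definition normal_covering_map :: "('a \<Rightarrow> 'b) \<Rightarrow> 'a sgraph \<Rightarrow> 'b sgraph \<Rightarrow> bool" where
  "normal_covering_map p F G \<longleftrightarrow>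
     covering_map p F G \<and>
     (\<forall>w\<in>gverts G. \<forall>x\<in>gverts F. \<forall>y\<in>gverts F.
        p x = w \<and> p y = w \<longrightarrow> (\<exists>\<phi>. deck_transformation p F \<phi> \<and> \<phi> x = y))"

lemma simple_graph_lattice: "simple_graph (lattice_graph d)"
proof -
  have "\<exists>a\<in>gverts (lattice_graph d). \<exists>b\<in>gverts (lattice_graph d). a \<noteq> b \<and> e = {a, b}"
    if e: "e \<in> gedges (lattice_graph d)" for e
  proof -
    from e obtain x i where x: "\<forall>j\<ge>d. x j = 0" "i < d" "e = {x, x(i := x i + 1)}"
      by (auto simp: lattice_graph_def)
    have "x \<noteq> x(i := x i + 1)"
      by (metis fun_upd_same less_add_one less_irrefl)
    with x show ?thesis
      by (intro bexI[of _ x] bexI[of _ "x(i := x i + 1)"]) (auto simp: lattice_graph_def)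
  qed
  then show ?thesis
    by (simp add: simple_graph_def)
qed

end

theory Submission imports Defs "HOL-Library.Function_Algebras" begin

text \<open>Call a map from the lattice to \<open>G\<close> a chart at \<open>v\<close> if it is a local isomorphism near the origin
  with value \<open>v\<close> there. In the lattice the two-step vertices are recovered from the one-step
  vertices: \<open>t + u\<close> is the other common neighbour of \<open>t\<close> and \<open>u\<close>, and \<open>2t\<close> is the only
  remaining neighbour of \<open>t\<close>. So a chart is determined on the ball of radius 2 by its frame, that
  is its restriction to the ball of radius 1, and two frames at the same vertex differ by a signed
  permutation of the coordinates. Since charts on the ball of radius 3 exist everywhere, a frame can
  be transported along a unit step by shifting a chart that extends it. Shifts by different steps
  commute, so \<open>\<int>\<^sup>d\<close> acts on the frames; the base vertex of the image of a fixed frame under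
  \<open>z \<in> \<int>\<^sup>d\<close> is the covering map. A covering map of this kind is determined by its frame at any
  single point, so a signed permutation relating the frames at two points of a fibre yields the
  deck transformation that carries one point to the other.\<close>

subsection \<open>Steps in the lattice\<close>

definition unit_vec :: "nat \<Rightarrow> nat \<Rightarrow> int" where
  "unit_vec i = (\<lambda>k. if k = i then 1 else 0)"

definition steps :: "nat \<Rightarrow> (nat \<Rightarrow> int) set" where
  "steps d = unit_vec ` {..<d} \<union> (\<lambda>i. - unit_vec i) ` {..<d}"

lemma unit_vec_in_steps: "i < d \<Longrightarrow> unit_vec i \<in> steps d"
  by (simp add: steps_def)

lemma uminus_in_steps: "s \<in> steps d \<Longrightarrow> - s \<in> steps d"
  by (auto simp: steps_def)

lemma stepsE:
  assumes "s \<in> steps d"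
  obtains i c where "i < d" "c = 1 \<or> c = -1" "s = (\<lambda>k. if k = i then c else 0)"
proof -
  from assms obtain i where i: "i < d" "s = unit_vec i \<or> s = - unit_vec i"
    by (auto simp: steps_def)
  have "unit_vec i = (\<lambda>k. if k = i then 1 else 0)" "- unit_vec i = (\<lambda>k. if k = i then - 1 else 0)"
    by (auto simp: unit_vec_def)
  with i that[of i 1] that[of i "- 1"] show thesis by auto
qed

lemma step_neq_uminus:
  assumes "s \<in> steps d"
  shows "s \<noteq> - s"
proof
  obtain i c where "i < d" "c = 1 \<or> c = -1" "s = (\<lambda>k. if k = i then c else 0)"
    using assms by (rule stepsE)
  moreover assume "s = - s"
  then have "s i = (- s) i" by (rule arg_cong)
  ultimately show False by auto
qed

text \<open>A nonzero sum of two steps determines its unordered pair of summands. Hence distinct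
  neighbours \<open>t\<close> and \<open>u\<close> of 0 have only 0 and \<open>t + u\<close> as
  common neighbours.\<close>

lemma steps_add_eq_cases:
  assumes "t \<in> steps d" "a \<in> steps d" "u \<in> steps d" "b \<in> steps d" "t + a = u + b"
  shows "t = u \<or> a = u \<or> t + a = 0"
proof -
  obtain i p where t: "i < d" "p = 1 \<or> p = -1" "t = (\<lambda>k. if k = i then p else 0)"
    using assms(1) by (rule stepsE)
  obtain j q where a: "j < d" "q = 1 \<or> q = -1" "a = (\<lambda>k. if k = j then q else 0)"
    using assms(2) by (rule stepsE)
  obtain l m where u: "l < d" "m = 1 \<or> m = -1" "u = (\<lambda>k. if k = l then m else 0)"
    using assms(3) by (rule stepsE)
  obtain n o' where b: "n < d" "o' = 1 \<or> o' = -1" "b = (\<lambda>k. if k = n then o' else 0)"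
    using assms(4) by (rule stepsE)
  have eq: "t k + a k = u k + b k" for k
    using fun_cong[OF assms(5), of k] by simp
  show ?thesis
  proof (cases "i = j \<and> p = - q")
    case True
    then have "t + a = 0" by (auto simp: fun_eq_iff t(3) a(3))
    then show ?thesis by blast
  next
    case False
    \<comment> \<open>As \<open>t\<close> and \<open>a\<close> do not cancel, neither do
      \<open>u\<close> and \<open>b\<close>; comparing values at the four support coordinates then
      matches \<open>u\<close> with a summand on the left.\<close>
    then have "(i = l \<and> p = m) \<or> (j = l \<and> q = m)"
      using eq[of i] eq[of j] eq[of l] eq[of n] t(2) a(2) u(2) b(2)
      unfolding t(3) a(3) u(3) b(3) by (auto split: if_splits)
    then show ?thesis by (auto simp: fun_eq_iff t(3) a(3) u(3))
  qed
qed

lemma zero_in_gverts_lattice: "0 \<in> gverts (lattice_graph d)"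
  by (simp add: lattice_graph_def)

lemma add_in_gverts_lattice:
  "x \<in> gverts (lattice_graph d) \<Longrightarrow> y \<in> gverts (lattice_graph d) \<Longrightarrow> x + y \<in> gverts (lattice_graph d)"
  by (simp add: lattice_graph_def)

lemma diff_in_gverts_lattice:
  "x \<in> gverts (lattice_graph d) \<Longrightarrow> y \<in> gverts (lattice_graph d) \<Longrightarrow> x - y \<in> gverts (lattice_graph d)"
  by (simp add: lattice_graph_def)

lemma steps_subset_gverts: "steps d \<subseteq> gverts (lattice_graph d)"
  by (auto simp: lattice_graph_def elim!: stepsE)

lemma lattice_edge_iff:
  assumes "x \<in> gverts (lattice_graph d)" "y \<in> gverts (lattice_graph d)"
  shows "{x, y} \<in> gedges (lattice_graph d) \<longleftrightarrow> y - x \<in> steps d"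
proof
  have upd: "a(i := a i + 1) = a + unit_vec i" for a :: "nat \<Rightarrow> int" and i
    by (auto simp: unit_vec_def)
  {
    assume "{x, y} \<in> gedges (lattice_graph d)"
    then obtain a i where "i < d" "{x, y} = {a, a + unit_vec i}"
      by (auto simp: lattice_graph_def upd)
    then show "y - x \<in> steps d"
      by (auto simp: doubleton_eq_iff unit_vec_in_steps uminus_in_steps)
  next
    assume "y - x \<in> steps d"
    then obtain i where i: "i < d" "y - x = unit_vec i \<or> y - x = - unit_vec i"
      by (auto simp: steps_def)
    then have "y = x + unit_vec i \<or> x = y + unit_vec i"
      by (auto simp: algebra_simps)
    with i(1) assms show "{x, y} \<in> gedges (lattice_graph d)"
      unfolding lattice_graph_def by (auto simp: upd insert_commute)
  }
qed

lemma neighbours_lattice: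
  assumes "x \<in> gverts (lattice_graph d)"
  shows "neighbours (lattice_graph d) x = (+) x ` steps d"
proof (intro subset_antisym subsetI)
  fix y assume "y \<in> neighbours (lattice_graph d) x"
  then have "y - x \<in> steps d"
    using assms by (auto simp: neighbours_def lattice_edge_iff)
  then have "x + (y - x) \<in> (+) x ` steps d" by (rule imageI)
  then show "y \<in> (+) x ` steps d" by simp
next
  fix y assume "y \<in> (+) x ` steps d"
  then show "y \<in> neighbours (lattice_graph d) x"
    using assms steps_subset_gverts[of d] add_in_gverts_lattice
    by (auto simp: neighbours_def lattice_edge_iff)
qed

text \<open>Coordinates are filled in one at a time, each by two-sided induction on its integer
  value, so finitely many steps lead from 0 to any lattice point.\<close>

lemma lattice_induct [consumes 1, case_names zero step]:
  assumes x: "x \<in> gverts (lattice_graph d)"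
    and 0: "P 0"
    and step: "\<And>x s. x \<in> gverts (lattice_graph d) \<Longrightarrow> s \<in> steps d \<Longrightarrow> P x \<Longrightarrow> P (x + s)"
  shows "P x"
proof -
  have "\<forall>x. (\<forall>i\<ge>n. x i = 0) \<longrightarrow> P x" if "n \<le> d" for n
    using that
  proof (induction n)
    case 0
    then show ?case using assms(2) by (auto simp: fun_eq_iff zero_fun_def[symmetric] ext[of _ 0])
  next
    case (Suc n)
    have L: "(\<forall>i\<ge>Suc n. x i = 0) \<Longrightarrow> x \<in> gverts (lattice_graph d)" for x :: "nat \<Rightarrow> int"
      using Suc.prems by (auto simp: lattice_graph_def)
    have "P (x(n := k))" if x: "\<forall>i\<ge>Suc n. x i = 0" for x and k :: int
    proof (induction k rule: int_induct[where k = 0])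
      case base
      have "\<forall>i\<ge>n. (x(n := 0)) i = 0" using x by (auto simp: Suc_le_eq)
      then show ?case using Suc.IH Suc.prems by simp
    next
      case (step1 i)
      have "x(n := i + 1) = x(n := i) + unit_vec n" by (auto simp: unit_vec_def)
      moreover have "x(n := i) \<in> gverts (lattice_graph d)" using x by (intro L) auto
      ultimately show ?case
        using step[OF _ unit_vec_in_steps[of n d]] step1(2) Suc.prems by (metis Suc_le_lessD)
    next
      case (step2 i)
      have "x(n := i - 1) = x(n := i) + - unit_vec n" by (auto simp: unit_vec_def)
      moreover have "x(n := i) \<in> gverts (lattice_graph d)" using x by (intro L) auto
      ultimately show ?case
        using step[OF _ uminus_in_steps[OF unit_vec_in_steps[of n d]]] step2(2) Suc.prems
        by (metis Suc_le_lessD)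
    qed
    \<comment> \<open>Taking \<open>k\<close> to be \<open>x n\<close> makes the update
      trivial.\<close>
    from this[of _ "_ n"] show ?case by (metis fun_upd_triv)
  qed
  from this[of d] x show ?thesis by (simp add: lattice_graph_def)
qed

subsection \<open>Balls\<close>

text \<open>Growing by neighbours supports induction on the radius; \<open>gball_eq_gdist\<close>
  identifies the result with the ball for the walk distance.\<close>

primrec gball :: "'a sgraph \<Rightarrow> 'a \<Rightarrow> nat \<Rightarrow> 'a set" where
  "gball G v 0 = {v}"
| "gball G v (Suc r) = gball G v r \<union> (\<Union>x\<in>gball G v r. neighbours G x)"

lemma gball_mono: "m \<le> n \<Longrightarrow> gball G v m \<subseteq> gball G v n"
  by (rule lift_Suc_mono_le) auto

lemma gball_subset_gverts: "v \<in> gverts G \<Longrightarrow> gball G v r \<subseteq> gverts G"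
  by (induction r) (auto simp: neighbours_def)

lemma gdist_le_iff:
  "gdist G u v \<le> enat n \<longleftrightarrow> (\<exists>xs. gwalk G u xs v \<and> length xs \<le> Suc n)"
proof -
  \<comment> \<open>\<open>INF_less_iff\<close> yields a witnessing walk only from a strict bound,
    hence the detour through \<open>Suc n\<close>.\<close>
  have "gdist G u v \<le> enat n \<longleftrightarrow> gdist G u v < enat (Suc n)"
    by (cases "gdist G u v") auto
  also have "\<dots> \<longleftrightarrow> (\<exists>xs. gwalk G u xs v \<and> length xs - 1 < Suc n)"
    by (auto simp: gdist_def INF_less_iff)
  also have "\<dots> \<longleftrightarrow> (\<exists>xs. gwalk G u xs v \<and> length xs \<le> Suc n)"
    by (intro ex_cong1) auto
  finally show ?thesis .
qed

lemma gball_eq_gdist: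
  assumes v: "v \<in> gverts G"
  shows "{x \<in> gverts G. gdist G v x \<le> enat r} = gball G v r"
proof (intro subset_antisym subsetI)
  fix x assume "x \<in> {x \<in> gverts G. gdist G v x \<le> enat r}"
  then obtain xs where "gwalk G v xs x" "length xs \<le> Suc r"
    by (auto simp: gdist_le_iff)
  then show "x \<in> gball G v r"
  proof (induction xs arbitrary: x r rule: rev_induct)
    case Nil
    then show ?case by (simp add: gwalk_def)
  next
    case (snoc y ys)
    show ?case
    proof (cases "ys = []")
      case True
      with snoc.prems have "x = v" by (auto simp: gwalk_def)
      then show ?thesis using gball_mono[of 0 r G v] by auto
    next
      case False
      with snoc.prems have "gwalk G v ys (last ys)" "{last ys, x} \<in> gedges G" "x \<in> gverts G"
        by (auto simp: gwalk_def successively_append_iff)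
      moreover obtain r' where "r = Suc r'" "length ys \<le> Suc r'"
        using snoc.prems(2) False by (cases r) auto
      ultimately show ?thesis using snoc.IH by (auto simp: neighbours_def)
    qed
  qed
next
  fix x assume "x \<in> gball G v r"
  then have "\<exists>xs. gwalk G v xs x \<and> length xs \<le> Suc r"
  proof (induction r arbitrary: x)
    case 0
    then show ?case using v by (intro exI[of _ "[v]"]) (auto simp: gwalk_def)
  next
    case (Suc r)
    show ?case
    proof (cases "x \<in> gball G v r")
      case True
      then show ?thesis using Suc.IH le_SucI by blast
    next
      case False
      with Suc.prems obtain y where "y \<in> gball G v r" "x \<in> neighbours G y" by auto
      with Suc.IH obtain xs where "gwalk G v xs y" "length xs \<le> Suc r" by blast
      with \<open>x \<in> neighbours G y\<close> show ?thesis
        by (intro exI[of _ "xs @ [x]"]) (auto simp: gwalk_def neighbours_def successively_append_iff)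
    qed
  qed
  then show "x \<in> {x \<in> gverts G. gdist G v x \<le> enat r}"
    using \<open>x \<in> gball G v r\<close> gball_subset_gverts[OF v] by (auto simp: gdist_le_iff)
qed

abbreviation lball :: "nat \<Rightarrow> nat \<Rightarrow> (nat \<Rightarrow> int) set" where
  "lball d r \<equiv> gball (lattice_graph d) 0 r"

lemma lball_subset: "lball d r \<subseteq> gverts (lattice_graph d)"
  by (intro gball_subset_gverts zero_in_gverts_lattice)

lemma lball_Suc: "lball d (Suc r) = lball d r \<union> (\<Union>x\<in>lball d r. (+) x ` steps d)"
  proof -
  have "neighbours (lattice_graph d) x = (+) x ` steps d" if "x \<in> lball d r" for x
    using that lball_subset neighbours_lattice by blast
  then show ?thesis by simp
qed

declare gball.simps(2) [simp del]

lemma zero_in_lball: "0 \<in> lball d r"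
  using gball_mono[of 0 r] by auto

lemma lball_1: "lball d 1 = insert 0 (steps d)"
  using lball_Suc[of d 0] by simp

lemma step_in_lball: "s \<in> steps d \<Longrightarrow> s \<in> lball d (Suc r)"
  using lball_1[of d] gball_mono[of 1 "Suc r" "lattice_graph d" 0] by auto

lemma add_step_in_lball: "x \<in> lball d r \<Longrightarrow> s \<in> steps d \<Longrightarrow> x + s \<in> lball d (Suc r)"
  by (auto simp: lball_Suc)

lemma lball_2_cases:
  assumes "x \<in> lball d 2"
  obtains "x \<in> lball d 1" | t u where "t \<in> steps d" "u \<in> steps d" "x = t + u"
proof -
  have "x \<in> lball d (Suc 1)" using assms by (simp add: numeral_2_eq_2)
  then consider "x \<in> lball d 1" | y s where "y \<in> lball d 1" "s \<in> steps d" "x = y + s"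
    unfolding lball_Suc[of d 1] by blast
  then show ?thesis
  proof cases
    case (2 y s)
    then show ?thesis using that unfolding lball_1 by auto
  qed (rule that)
qed

lemma lattice_exhausted: "x \<in> gverts (lattice_graph d) \<Longrightarrow> \<exists>r. x \<in> lball d r"
proof (induction x rule: lattice_induct)
  case zero
  then show ?case using zero_in_lball by blast
next
  case (step x s)
  then show ?case using add_step_in_lball by blast
qed

subsection \<open>Charts\<close>

text \<open>Full neighbourhoods are matched up to radius \<open>r\<close>, while injectivity reaches
  one further. As in \<open>link_minus\<close>, nothing is said about edges between two points of
  the outer sphere, so charts of radius \<open>r\<close> correspond to links of radius
  \<open>r + 1\<close>.\<close>

definition chart :: "nat \<Rightarrow> 'a sgraph \<Rightarrow> nat \<Rightarrow> ((nat \<Rightarrow> int) \<Rightarrow> 'a) \<Rightarrow> bool" where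
  "chart d G r h \<longleftrightarrow> inj_on h (lball d (Suc r)) \<and>
     (\<forall>x\<in>lball d r. h x \<in> gverts G \<and> neighbours G (h x) = (\<lambda>s. h (x + s)) ` steps d)"

lemma chart_mono: "chart d G n h \<Longrightarrow> m \<le> n \<Longrightarrow> chart d G m h"
  unfolding chart_def
  by (meson Suc_le_mono gball_mono inj_on_subset subsetD)

lemma chart_cong:
  assumes "\<And>x. x \<in> lball d (Suc r) \<Longrightarrow> h x = g x"
  shows "chart d G r h \<longleftrightarrow> chart d G r g"
proof -
  have "h x = g x" if "x \<in> lball d r" for x
    using assms that gball_mono[of r "Suc r" "lattice_graph d" 0] by auto
  moreover have "h (x + s) = g (x + s)" if "x \<in> lball d r" "s \<in> steps d" for x s
    using assms that add_step_in_lball by blast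
  ultimately show ?thesis
    unfolding chart_def using inj_on_cong[of "lball d (Suc r)" h g] assms
    by (auto simp: image_def)
qed

text \<open>A shift costs one unit of radius, because a ball moved by a step stays in the ball of
  the next radius.\<close>

lemma chart_shift:
  assumes h: "chart d G (Suc r) h" and s: "s \<in> steps d"
  shows "chart d G r (\<lambda>x. h (s + x))"
proof -
  have sh: "s + x \<in> lball d (Suc n)" if "x \<in> lball d n" for x n
    using add_step_in_lball[OF that s] by (simp add: add.commute)
  have "inj_on (\<lambda>x. h (s + x)) (lball d (Suc r))"
  proof (rule inj_onI)
    fix x y assume "x \<in> lball d (Suc r)" "y \<in> lball d (Suc r)" "h (s + x) = h (s + y)"
    then have "s + x = s + y" using h sh unfolding chart_def inj_on_def by blast
    then show "x = y" by simp
  qed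
  with h sh show ?thesis unfolding chart_def by (simp add: add.assoc)
qed

section \<open>Charts from isomorphisms of links\<close>

lemma link_minus_edge_iff:
  assumes v: "v \<in> gverts G" and xy: "x \<in> gverts G" "y \<in> gverts G"
  shows "{x, y} \<in> gedges (link_minus (Suc r) v G) \<longleftrightarrow>
    {x, y} \<in> gedges G \<and> (x \<in> gball G v r \<or> y \<in> gball G v r)"
proof -
  have lt: "gdist G v x < enat (Suc r) \<longleftrightarrow> x \<in> gball G v r" if "x \<in> gverts G" for x
    using that gball_eq_gdist[OF v, of r, symmetric] by (cases "gdist G v x") auto
  show ?thesis
    using xy by (fastforce simp: link_minus_def min_less_iff_disj lt doubleton_eq_iff insert_commute)
qed

text \<open>The isomorphism matches the vertex sets of whole links. That it also carries each
  smaller ball onto the ball of the same radius is an induction in which \<open>nb\<close> at radius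
  \<open>k\<close> gives \<open>img\<close> at radius \<open>k + 1\<close>.\<close>

lemma link_iso_chart:
  assumes v: "v \<in> gverts G"
    and iso: "graph_iso f (link_minus (Suc n) (\<lambda>_. 0) (lattice_graph d)) (link_minus (Suc n) v G)"
    and f0: "f (\<lambda>_. 0) = v"
  shows "chart d G n f"
proof -
  have z: "(\<lambda>_. 0) = (0 :: nat \<Rightarrow> int)" by (simp add: zero_fun_def)
  have gv: "gverts (link_minus (Suc n) 0 (lattice_graph d)) = lball d (Suc n)"
    "gverts (link_minus (Suc n) v G) = gball G v (Suc n)"
    using gball_eq_gdist[OF zero_in_gverts_lattice] gball_eq_gdist[OF v]
    by (simp_all add: link_minus_def)
  have bij: "bij_betw f (lball d (Suc n)) (gball G v (Suc n))"
    using iso by (simp only: graph_iso_def z gv)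
  have edge: "{x, y} \<in> gedges (lattice_graph d) \<and> (x \<in> lball d n \<or> y \<in> lball d n) \<longleftrightarrow>
      {f x, f y} \<in> gedges G \<and> (f x \<in> gball G v n \<or> f y \<in> gball G v n)"
    if "x \<in> lball d (Suc n)" "y \<in> lball d (Suc n)" for x y
  proof -
    have V: "x \<in> gverts (lattice_graph d)" "y \<in> gverts (lattice_graph d)"
      "f x \<in> gverts G" "f y \<in> gverts G"
      using that lball_subset bij_betwE[OF bij] gball_subset_gverts[OF v] by blast+
    have "\<forall>x\<in>lball d (Suc n). \<forall>y\<in>lball d (Suc n).
        {x, y} \<in> gedges (link_minus (Suc n) 0 (lattice_graph d)) \<longleftrightarrow>
        {f x, f y} \<in> gedges (link_minus (Suc n) v G)"
      using iso unfolding graph_iso_def z gv by (rule conjunct2)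
    from this[rule_format, OF that] show ?thesis
      unfolding link_minus_edge_iff[OF zero_in_gverts_lattice V(1,2)]
        link_minus_edge_iff[OF v V(3,4)] .
  qed
  \<comment> \<open>The assumption \<open>k(2)\<close> puts \<open>f x\<close> in the ball of radius
    \<open>n\<close>, so all edges at \<open>x\<close> and at \<open>f x\<close> belong to the
    links.\<close>
  have nb: "neighbours G (f x) = (\<lambda>s. f (x + s)) ` steps d"
    if k: "k \<le> n" "f ` lball d k = gball G v k" and x: "x \<in> lball d k" for k x
  proof -
    have xn: "x \<in> lball d n"
      using gball_mono[OF k(1)] x by (rule subsetD)
    have "f x \<in> gball G v k" using imageI[OF x, of f] by (simp only: k(2))
    then have fxn: "f x \<in> gball G v n" by (rule subsetD[OF gball_mono[OF k(1)]])
    have xL: "x \<in> gverts (lattice_graph d)" using lball_subset xn by (rule subsetD)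
    have xS: "x \<in> lball d (Suc n)" using gball_mono[OF le_SucI[OF le_refl]] xn by (rule subsetD)
    have "neighbours G (f x) = f ` neighbours (lattice_graph d) x"
    proof (intro subset_antisym subsetI)
      fix w assume w: "w \<in> neighbours G (f x)"
      then have "w \<in> gball G v (Suc n)" using fxn by (auto simp: gball.simps(2))
      then obtain y where y: "y \<in> lball d (Suc n)" "w = f y"
        using bij by (metis bij_betw_imp_surj_on imageE)
      then have "{x, y} \<in> gedges (lattice_graph d)"
        using edge[OF xS y(1)] w fxn by (simp add: neighbours_def)
      then show "w \<in> f ` neighbours (lattice_graph d) x"
        using y lball_subset by (auto simp: neighbours_def)
    next
      fix w assume "w \<in> f ` neighbours (lattice_graph d) x"
      then obtain y where y: "w = f y" "y \<in> neighbours (lattice_graph d) x" by blast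
      then have y2: "y \<in> lball d (Suc n)" using xn by (auto simp: gball.simps(2))
      then have "f y \<in> gverts G" using bij_betwE[OF bij] gball_subset_gverts[OF v] by blast
      then show "w \<in> neighbours G (f x)"
        using edge[OF xS y2] y xn by (simp add: neighbours_def)
    qed
    then show ?thesis by (simp add: neighbours_lattice[OF xL] image_image)
  qed
  have img: "k \<le> n \<Longrightarrow> f ` lball d k = gball G v k" for k
  proof (induction k)
    case 0
    then show ?case using f0 by (simp add: z)
  next
    case (Suc k)
    then have "k \<le> n" by simp
    then have IH: "f ` lball d k = gball G v k" by (rule Suc.IH)
    have "f ` lball d (Suc k) = f ` lball d k \<union> (\<Union>x\<in>lball d k. (\<lambda>s. f (x + s)) ` steps d)"
      by (auto simp: lball_Suc)
    also have "\<dots> = f ` lball d k \<union> (\<Union>x\<in>lball d k. neighbours G (f x))"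
      using nb[OF \<open>k \<le> n\<close> IH] by simp
    also have "\<dots> = gball G v (Suc k)"
      unfolding gball.simps(2) IH[symmetric] by (simp only: UN_simps(10))
    finally show ?case .
  qed
  have "f x \<in> gverts G" if "x \<in> lball d n" for x
    using imageI[OF that, of f] subsetD[OF gball_subset_gverts[OF v]] by (simp only: img[OF le_refl])
  then show ?thesis
    unfolding chart_def using bij nb[OF le_refl img[OF le_refl]] by (simp add: bij_betw_def)
qed

section \<open>Rigidity of charts\<close>

lemma chart_injD:
  assumes "chart d G r h" "h x = h y" "x \<in> lball d (Suc r)" "y \<in> lball d (Suc r)"
  shows "x = y"
  using assms by (auto simp: chart_def inj_on_def)

lemma chart_neighbours:
  assumes "chart d G r h" "x \<in> lball d r"
  shows "neighbours G (h x) = (\<lambda>s. h (x + s)) ` steps d"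
  using assms by (auto simp: chart_def)

text \<open>Injectivity turns an equality of values into an equation between sums of steps, where
  \<open>steps_add_eq_cases\<close> applies. For \<open>u = - t\<close> the conclusion contradicts
  \<open>w \<noteq> h 0\<close>, so opposite neighbours share only the centre.\<close>

lemma chart_common_neighbour:
  assumes h: "chart d G 1 h" and tu: "t \<in> steps d" "u \<in> steps d" "t \<noteq> u"
    and w: "w \<in> neighbours G (h t)" "w \<in> neighbours G (h u)" "w \<noteq> h 0"
  shows "w = h (t + u)"
proof -
  have nb: "neighbours G (h x) = (\<lambda>s. h (x + s)) ` steps d" if "x \<in> steps d" for x
    using chart_neighbours[OF h] step_in_lball[OF that, of 0] by simp
  obtain a b where ab: "a \<in> steps d" "b \<in> steps d" "w = h (t + a)" "w = h (u + b)"
    using w nb tu by auto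
  have "t + a = u + b"
    using chart_injD[OF h, of "t + a" "u + b"] ab tu add_step_in_lball[OF step_in_lball[of _ d 0]] by simp
  with steps_add_eq_cases[OF tu(1) ab(1) tu(2) ab(2)] tu(3) ab(3) w(3) show ?thesis by (auto simp: add.commute)
qed

text \<open>Radius 1 already makes both maps injective on the ball of radius 2. Sums of distinct,
  non-opposite steps are settled first as common neighbours; doubled steps then follow by
  exclusion.\<close>

lemma charts_agree_ball_2:
  assumes h: "chart d G 1 h" and g: "chart d G 1 g"
    and eq: "\<And>x. x \<in> lball d 1 \<Longrightarrow> g x = h x"
    and x: "x \<in> lball d 2"
  shows "g x = h x"
proof -
  have nb: "neighbours G (k x) = (\<lambda>s. k (x + s)) ` steps d" if "x \<in> steps d" "chart d G 1 k" for x k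
    using chart_neighbours[OF that(2)] step_in_lball[OF that(1), of 0] by simp
  have eqs: "g 0 = h 0" "\<And>s. s \<in> steps d \<Longrightarrow> g s = h s"
    using eq by (auto simp: lball_1 simp del: One_nat_def)
  have ball2: "t + u \<in> lball d (Suc 1)" if "t \<in> steps d" "u \<in> steps d" for t u
    using add_step_in_lball[OF step_in_lball[of _ d 0]] that by simp
  have ne0: "g (t + u) \<noteq> h 0" if tu: "t \<in> steps d" "u \<in> steps d" "t + u \<noteq> 0" for t u
    using chart_injD[OF g _ ball2 zero_in_lball] tu eqs by metis
  have sum: "g (t + u) = h (t + u)" if tu: "t \<in> steps d" "u \<in> steps d" "t \<noteq> u" "t + u \<noteq> 0" for t u
  proof (rule chart_common_neighbour[OF h tu(1-3)])
    show "g (t + u) \<in> neighbours G (h t)"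
      using nb[OF tu(1) g] eqs(2)[OF tu(1)] tu by auto
    show "g (t + u) \<in> neighbours G (h u)"
      using nb[OF tu(2) g] eqs(2)[OF tu(2)] tu by (auto simp: add.commute)
    show "g (t + u) \<noteq> h 0" using ne0 tu by blast
  qed
  have double: "g (t + t) = h (t + t)" if t: "t \<in> steps d" for t
  proof -
    have "g (t + t) \<in> neighbours G (g t)"
      unfolding nb[OF t g] using t by (rule imageI)
    then have "g (t + t) \<in> neighbours G (h t)" by (simp only: eqs(2)[OF t])
    then obtain a where a: "a \<in> steps d" "g (t + t) = h (t + a)" using nb[OF t h] by auto
    have "t + t \<noteq> 0" using step_neq_uminus[OF t] by (metis minus_unique)
    then have "t + a \<noteq> 0" using ne0[OF t t] a(2) by metis
    \<comment> \<open>If \<open>a\<close> differs from \<open>t\<close>, then \<open>sum\<close>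
      gives \<open>g (t + a) = h (t + a) = g (t + t)\<close>, against the injectivity of
      \<open>g\<close>.\<close>
    show ?thesis
    proof (cases "a = t")
      case True
      then show ?thesis using a by simp
    next
      case False
      then have "g (t + t) = g (t + a)" using sum[OF t a(1)] \<open>t + a \<noteq> 0\<close> a(2) by metis
      then have "t + t = t + a" using chart_injD[OF g _ ball2 ball2] t a by blast
      with False show ?thesis by simp
    qed
  qed
  show ?thesis
    using x
  proof (cases rule: lball_2_cases)
    case 1
    then show ?thesis using eq by simp
  next
    case (2 t u)
    then show ?thesis using sum[of t u] double eqs(1) by metis
  qed
qed

subsection \<open>Signed permutations\<close>

text \<open>An abstract form of the signed permutations of the coordinates. Injectivity is asked on
  the lattice only, since \<open>linear_ext\<close> ignores coordinates from \<open>d\<close>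
  on.\<close>

definition lattice_symmetry :: "nat \<Rightarrow> ((nat \<Rightarrow> int) \<Rightarrow> nat \<Rightarrow> int) \<Rightarrow> bool" where
  "lattice_symmetry d \<sigma> \<longleftrightarrow> (\<forall>x y. \<sigma> (x + y) = \<sigma> x + \<sigma> y) \<and>
     inj_on \<sigma> (gverts (lattice_graph d)) \<and> \<sigma> ` steps d = steps d"

definition linear_ext :: "nat \<Rightarrow> ((nat \<Rightarrow> int) \<Rightarrow> nat \<Rightarrow> int) \<Rightarrow> (nat \<Rightarrow> int) \<Rightarrow> nat \<Rightarrow> int" where
  "linear_ext d \<sigma> x = (\<lambda>k. \<Sum>i<d. x i * \<sigma> (unit_vec i) k)"

lemma linear_ext_add: "linear_ext d \<sigma> (x + y) = linear_ext d \<sigma> x + linear_ext d \<sigma> y"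
  by (auto simp: linear_ext_def algebra_simps sum.distrib)

text \<open>The extension is built from the positive unit vectors alone; oddness makes it agree with
  \<open>\<sigma>\<close> on the negative ones.\<close>

lemma linear_ext_step:
  assumes odd: "\<And>s. s \<in> steps d \<Longrightarrow> \<sigma> (- s) = - \<sigma> s" and s: "s \<in> steps d"
  shows "linear_ext d \<sigma> s = \<sigma> s"
proof -
  have 1: "linear_ext d \<sigma> (unit_vec i) = \<sigma> (unit_vec i)" if "i < d" for i
    using that by (auto simp: linear_ext_def unit_vec_def if_distrib[of "\<lambda>z. z * _"] cong: if_cong)
  have "linear_ext d \<sigma> (- unit_vec i) = - linear_ext d \<sigma> (unit_vec i)" for i
    by (auto simp: linear_ext_def sum_negf)
  with 1 odd[OF unit_vec_in_steps] s show ?thesis by (auto simp: steps_def)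
qed

text \<open>Injectivity comes from a left inverse, the extension of the inverse permutation of the
  steps, which is odd as well.\<close>

lemma lattice_symmetry_linear_ext:
  assumes bij: "bij_betw \<sigma> (steps d) (steps d)"
    and odd: "\<And>s. s \<in> steps d \<Longrightarrow> \<sigma> (- s) = - \<sigma> s"
  shows "lattice_symmetry d (linear_ext d \<sigma>)"
proof -
  define \<tau> where "\<tau> = inv_into (steps d) \<sigma>"
  have \<tau>: "\<tau> (\<sigma> s) = s" if "s \<in> steps d" for s
    using that bij by (simp add: \<tau>_def bij_betw_inv_into_left)
  have \<sigma>in: "\<sigma> s \<in> steps d" if "s \<in> steps d" for s using bij that by (rule bij_betw_apply)
  have odd': "\<tau> (- s) = - \<tau> s" if "s \<in> steps d" for s
  proof -
    have "s \<in> \<sigma> ` steps d" using that bij by (simp add: bij_betw_def)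
    then obtain t where t: "t \<in> steps d" "s = \<sigma> t" by (rule imageE)
    then show ?thesis using \<tau>[OF uminus_in_steps[OF t(1)]] \<tau>[OF t(1)] odd[OF t(1)] by simp
  qed
  have inv: "linear_ext d \<tau> (linear_ext d \<sigma> x) = x" if "x \<in> gverts (lattice_graph d)" for x
    using that
  proof (induction x rule: lattice_induct)
    case zero
    then show ?case by (auto simp: linear_ext_def)
  next
    case (step x s)
    then show "linear_ext d \<tau> (linear_ext d \<sigma> (x + s)) = x + s"
      by (simp add: linear_ext_add linear_ext_step[where \<sigma> = \<sigma>, OF odd] linear_ext_step[where \<sigma> = \<tau>, OF odd'] \<sigma>in \<tau>)
  qed
  have "linear_ext d \<sigma> ` steps d = \<sigma> ` steps d"
    using linear_ext_step[where \<sigma> = \<sigma>, OF odd] by (intro image_cong) auto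
  also have "\<dots> = steps d" using bij by (simp add: bij_betw_def)
  finally show ?thesis
    using inv by (auto simp: lattice_symmetry_def linear_ext_add intro: inj_on_inverseI)
qed

context
  fixes d :: nat and \<sigma> :: "(nat \<Rightarrow> int) \<Rightarrow> nat \<Rightarrow> int"
  assumes sym: "lattice_symmetry d \<sigma>"
begin

lemma symmetry_add: "\<sigma> (x + y) = \<sigma> x + \<sigma> y"
  using sym by (simp add: lattice_symmetry_def)

lemma symmetry_zero: "\<sigma> 0 = 0"
  using symmetry_add[of 0 0] by (metis add_0_right add_left_cancel)

lemma symmetry_diff: "\<sigma> (x - y) = \<sigma> x - \<sigma> y"
  using symmetry_add[of "x - y" y] by (simp add: algebra_simps)

lemma symmetry_inj: "inj_on \<sigma> (gverts (lattice_graph d))"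
  using sym by (simp add: lattice_symmetry_def)

lemma symmetry_steps: "\<sigma> ` steps d = steps d"
  using sym by (simp add: lattice_symmetry_def)

lemma symmetry_lball: "\<sigma> ` lball d r = lball d r"
proof (induction r)
  case 0
  then show ?case by (simp only: gball.simps(1) image_insert image_empty symmetry_zero)
next
  case (Suc r)
  have "\<sigma> ` lball d (Suc r) = \<sigma> ` lball d r \<union> (\<Union>x\<in>\<sigma> ` lball d r. (+) x ` \<sigma> ` steps d)"
    by (simp add: lball_Suc image_Un image_UN image_image symmetry_add)
  then show ?case by (simp only: Suc symmetry_steps lball_Suc)
qed

text \<open>Surjectivity holds because the lattice is the union of its balls and each ball is mapped
  onto itself.\<close>

lemma symmetry_gverts: "\<sigma> ` gverts (lattice_graph d) = gverts (lattice_graph d)"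
proof -
  have "gverts (lattice_graph d) = (\<Union>r. lball d r)"
  proof
    show "gverts (lattice_graph d) \<subseteq> (\<Union>r. lball d r)"
      using lattice_exhausted by (intro subsetI) simp
  qed (rule UN_least[OF lball_subset])
  then show ?thesis by (simp add: image_UN symmetry_lball)
qed

lemma symmetry_in_gverts: "x \<in> gverts (lattice_graph d) \<Longrightarrow> \<sigma> x \<in> gverts (lattice_graph d)"
  using imageI[of x "gverts (lattice_graph d)" \<sigma>] by (simp only: symmetry_gverts)

lemma symmetry_step_iff:
  assumes "x \<in> gverts (lattice_graph d)"
  shows "\<sigma> x \<in> steps d \<longleftrightarrow> x \<in> steps d"
  using inj_on_image_mem_iff[OF symmetry_inj assms steps_subset_gverts] by (simp add: symmetry_steps)

lemma chart_symmetry: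
  assumes h: "chart d G r h"
  shows "chart d G r (\<lambda>x. h (\<sigma> x))"
proof -
  have in_ball: "\<sigma> x \<in> lball d n" if "x \<in> lball d n" for x n
    using imageI[OF that, of \<sigma>] by (simp add: symmetry_lball)
  have "inj_on (h \<circ> \<sigma>) (lball d (Suc r))"
    using h symmetry_lball inj_on_subset[OF symmetry_inj lball_subset]
    by (auto simp: chart_def intro!: comp_inj_on)
  moreover have "(\<lambda>s. h (\<sigma> (x + s))) ` steps d = (\<lambda>s. h (\<sigma> x + s)) ` steps d" for x
  proof -
    have "(\<lambda>s. h (\<sigma> (x + s))) ` steps d = (\<lambda>s. h (\<sigma> x + s)) ` \<sigma> ` steps d"
      by (simp add: image_image symmetry_add)
    then show ?thesis by (simp add: symmetry_steps)
  qed
  ultimately show ?thesis using h in_ball by (simp add: chart_def comp_def)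
qed

end

text \<open>Opposite neighbours of the centre are those whose only common neighbour is the centre, so
  every chart sees the same opposite pairs.\<close>

lemma charts_differ_by_symmetry:
  assumes h: "chart d G 1 h" and f: "chart d G 1 f" and eq: "h 0 = f 0"
  obtains \<sigma> where "lattice_symmetry d \<sigma>" "\<And>x. x \<in> lball d 1 \<Longrightarrow> f (\<sigma> x) = h x"
proof -
  have nb0: "neighbours G (k 0) = k ` steps d" if "chart d G 1 k" for k
    using chart_neighbours[OF that zero_in_lball] by simp
  have nb: "neighbours G (k x) = (\<lambda>s. k (x + s)) ` steps d" if "x \<in> steps d" "chart d G 1 k" for x k
    using chart_neighbours[OF that(2)] step_in_lball[OF that(1), of 0] by simp
  have img: "h ` steps d = f ` steps d" using nb0 h f eq by metis
  have inj: "inj_on k (steps d)" if "chart d G 1 k" for k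
    using that step_in_lball[of _ d 1] unfolding chart_def inj_on_def by blast
  \<comment> \<open>Both charts enumerate the neighbours of the same vertex by the steps;
    \<open>\<sigma>\<close> translates one enumeration into the other.\<close>
  define \<sigma> where "\<sigma> = (\<lambda>s. inv_into (steps d) f (h s))"
  have f\<sigma>: "f (\<sigma> s) = h s" if "s \<in> steps d" for s
    using that img f_inv_into_f[of "h s" f "steps d"] by (auto simp: \<sigma>_def)
  have bij: "bij_betw \<sigma> (steps d) (steps d)"
    unfolding \<sigma>_def
    using bij_betw_trans[OF inj_on_imp_bij_betw[OF inj[OF h]], of "inv_into (steps d) f" "steps d"]
      bij_betw_inv_into[OF inj_on_imp_bij_betw[OF inj[OF f]]] by (simp add: img comp_def)
  have \<sigma>in: "\<sigma> s \<in> steps d" if "s \<in> steps d" for s using bij that by (rule bij_betw_apply)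
  have odd: "\<sigma> (- s) = - \<sigma> s" if s: "s \<in> steps d" for s
  proof (rule ccontr)
    assume "\<sigma> (- s) \<noteq> - \<sigma> s"
    then have ne: "\<sigma> s + \<sigma> (- s) \<noteq> 0" by (metis minus_unique)
    \<comment> \<open>If the images of \<open>s\<close> and \<open>- s\<close> were not opposite,
      \<open>?w\<close> would be a common neighbour of \<open>h s\<close> and \<open>h (- s)\<close>
      other than the centre.\<close>
    let ?w = "f (\<sigma> s + \<sigma> (- s))"
    note s' = uminus_in_steps[OF s]
    have "?w \<in> neighbours G (h s)"
      using nb[OF \<sigma>in[OF s] f] \<sigma>in[OF s'] f\<sigma>[OF s] by auto
    moreover have "?w \<in> neighbours G (h (- s))"
      using nb[OF \<sigma>in[OF s'] f] \<sigma>in[OF s] f\<sigma>[OF s'] by (auto simp: add.commute)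
    moreover have "?w \<noteq> h 0"
      using chart_injD[OF f _ _ zero_in_lball] ne eq
        add_step_in_lball[OF step_in_lball[of _ d 0]] \<sigma>in[OF s] \<sigma>in[OF s'] by (metis One_nat_def)
    ultimately have "?w = h (s + - s)" using chart_common_neighbour[OF h s s' step_neq_uminus[OF s]] by blast
    with \<open>?w \<noteq> h 0\<close> show False by simp
  qed
  show thesis
  proof
    show "lattice_symmetry d (linear_ext d \<sigma>)"
      by (rule lattice_symmetry_linear_ext[where \<sigma> = \<sigma>, OF bij odd])
    fix x assume "x \<in> lball d 1"
    then consider "x = 0" | "x \<in> steps d" by (auto simp: lball_1 simp del: One_nat_def)
    then show "f (linear_ext d \<sigma> x) = h x"
    proof cases
      case 1
      then show ?thesis
        using eq symmetry_zero[OF lattice_symmetry_linear_ext[where \<sigma> = \<sigma>, OF bij odd]] by simp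
    next
      case 2
      then show ?thesis using f\<sigma> linear_ext_step[where \<sigma> = \<sigma>, OF odd] by simp
    qed
  qed
qed

subsection \<open>Developing maps\<close>

text \<open>Radius 1 gives injectivity on every ball of radius 2 in the lattice, so that
  \<open>charts_agree_ball_2\<close> applies around each point.\<close>

definition developing :: "nat \<Rightarrow> 'a sgraph \<Rightarrow> ((nat \<Rightarrow> int) \<Rightarrow> 'a) \<Rightarrow> bool" where
  "developing d G p \<longleftrightarrow> (\<forall>x\<in>gverts (lattice_graph d). chart d G 1 (\<lambda>u. p (x + u)))"

text \<open>Rigidity enlarges agreement on the unit ball at \<open>x\<close> to the ball of radius
  2, which contains the unit ball at each \<open>x + s\<close>. Agreement on unit balls thus spreads
  by lattice induction.\<close>

lemma developing_eqI:
  assumes q: "developing d G q" and q': "developing d G q'"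
    and eq: "\<And>u. u \<in> lball d 1 \<Longrightarrow> q u = q' u"
    and x: "x \<in> gverts (lattice_graph d)"
  shows "q x = q' x"
proof -
  have "\<forall>u\<in>lball d 1. q (x + u) = q' (x + u)"
    using x
  proof (induction x rule: lattice_induct)
    case zero
    then show ?case unfolding add_0 using eq by blast
  next
    case (step x s)
    have "chart d G 1 (\<lambda>u. q (x + u))" "chart d G 1 (\<lambda>u. q' (x + u))"
      using q q' step(1) by (auto simp: developing_def)
    then have "q (x + u) = q' (x + u)" if "u \<in> lball d 2" for u
      using charts_agree_ball_2[of d G "\<lambda>u. q' (x + u)" "\<lambda>u. q (x + u)"] that step(3) by blast
    moreover have "s + u \<in> lball d 2" if "u \<in> lball d 1" for u
      using add_step_in_lball[OF that step(2)] by (simp add: add.commute numeral_2_eq_2)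
    ultimately have "q (x + (s + u)) = q' (x + (s + u))" if "u \<in> lball d 1" for u
      using that by simp
    then show ?case unfolding add.assoc by (rule ballI)
  qed
  from this[rule_format, OF zero_in_lball] show ?thesis by simp
qed

lemma developing_normal_covering_map:
  assumes p: "developing d G p"
  shows "normal_covering_map p (lattice_graph d) G"
proof -
  let ?L = "lattice_graph d"
  have ch: "chart d G 1 (\<lambda>u. p (x + u))" if "x \<in> gverts ?L" for x
    using p that by (simp add: developing_def)
  have nb: "neighbours G (p x) = (\<lambda>s. p (x + s)) ` steps d" and pV: "p x \<in> gverts G"
    if "x \<in> gverts ?L" for x
    using ch[OF that] zero_in_lball[of d 1] by (auto simp: chart_def)
  have "bij_betw p (neighbours ?L x) (neighbours G (p x))" if x: "x \<in> gverts ?L" for x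
  proof -
    have "inj_on p ((+) x ` steps d)"
      using ch[OF x] step_in_lball[of _ d 1]
      by (auto simp: chart_def inj_on_def)
    then show ?thesis
      by (simp add: nb[OF x] neighbours_lattice[OF x] bij_betw_def image_image)
  qed
  moreover have "{p x, p y} \<in> gedges G"
    if xy: "x \<in> gverts ?L" "y \<in> gverts ?L" "{x, y} \<in> gedges ?L" for x y
  proof -
    have "y - x \<in> steps d" using xy by (simp add: lattice_edge_iff)
    then have "p (x + (y - x)) \<in> neighbours G (p x)" using nb[OF xy(1)] by blast
    then show ?thesis by (simp add: neighbours_def)
  qed
  ultimately have cov: "covering_map p ?L G"
    using pV by (auto simp: covering_map_def graph_hom_def)
  have "\<exists>\<phi>. deck_transformation p ?L \<phi> \<and> \<phi> x = y"
    if x: "x \<in> gverts ?L" and y: "y \<in> gverts ?L" and pxy: "p x = p y" for x y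
  proof -
    \<comment> \<open>The charts at \<open>x\<close> and \<open>y\<close> have the same centre, so a
      signed permutation relates their frames.\<close>
    obtain \<sigma> where \<sigma>: "lattice_symmetry d \<sigma>"
      and eq: "\<And>u. u \<in> lball d 1 \<Longrightarrow> p (y + \<sigma> u) = p (x + u)"
      using charts_differ_by_symmetry[OF ch[OF x] ch[OF y]] pxy by auto
    have dev_x: "developing d G (\<lambda>z. p (x + z))"
      using p add_in_gverts_lattice[OF x] by (simp add: developing_def add.assoc[symmetric])
    have dev_y: "developing d G (\<lambda>z. p (y + \<sigma> z))"
      unfolding developing_def
    proof
      fix z assume "z \<in> gverts ?L"
      then have "y + \<sigma> z \<in> gverts ?L"
        by (intro add_in_gverts_lattice[OF y] symmetry_in_gverts[OF \<sigma>])
      from chart_symmetry[OF \<sigma> ch[OF this]]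
      show "chart d G 1 (\<lambda>u. p (y + \<sigma> (z + u)))" by (simp add: symmetry_add[OF \<sigma>] add.assoc)
    qed
    have same: "p (y + \<sigma> z) = p (x + z)" if "z \<in> gverts ?L" for z
      by (rule developing_eqI[OF dev_y dev_x _ that]) (rule eq)
    \<comment> \<open>The affine symmetry with linear part \<open>\<sigma>\<close> taking
      \<open>x\<close> to \<open>y\<close>; it preserves \<open>p\<close> by \<open>same\<close>
      applied to \<open>u - x\<close>.\<close>
    define \<phi> where "\<phi> u = y + \<sigma> (u - x)" for u
    have diff: "u - x \<in> gverts ?L" if "u \<in> gverts ?L" for u
      using diff_in_gverts_lattice[OF that x] .
    have \<phi>L: "\<phi> u \<in> gverts ?L" if "u \<in> gverts ?L" for u
      unfolding \<phi>_def by (intro add_in_gverts_lattice[OF y] symmetry_in_gverts[OF \<sigma>] diff that)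
    have "bij_betw \<phi> (gverts ?L) (gverts ?L)"
    proof (rule bij_betwI')
      fix u w assume "u \<in> gverts ?L" "w \<in> gverts ?L"
      then show "\<phi> u = \<phi> w \<longleftrightarrow> u = w"
        using inj_on_eq_iff[OF symmetry_inj[OF \<sigma>] diff diff] by (simp add: \<phi>_def)
    next
      fix w assume "w \<in> gverts ?L"
      then have "w - y \<in> \<sigma> ` gverts ?L"
        using diff_in_gverts_lattice[OF _ y] by (simp only: symmetry_gverts[OF \<sigma>])
      then obtain z where z: "w - y = \<sigma> z" "z \<in> gverts ?L" by (rule imageE)
      have "\<phi> (x + z) = y + (w - y)" by (simp only: \<phi>_def add_diff_cancel_left' z(1))
      then have "w = \<phi> (x + z)" by simp
      then show "\<exists>u\<in>gverts ?L. w = \<phi> u" by (rule bexI[OF _ add_in_gverts_lattice[OF x z(2)]])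
    qed (rule \<phi>L)
    moreover have "{u, w} \<in> gedges ?L \<longleftrightarrow> {\<phi> u, \<phi> w} \<in> gedges ?L"
      if uw: "u \<in> gverts ?L" "w \<in> gverts ?L" for u w
    proof -
      have "\<phi> w - \<phi> u = \<sigma> (w - u)" by (simp add: \<phi>_def symmetry_diff[OF \<sigma>])
      then show ?thesis
        using symmetry_step_iff[OF \<sigma> diff_in_gverts_lattice[OF uw(2,1)]]
        by (simp add: lattice_edge_iff uw \<phi>L)
    qed
    moreover have "p (\<phi> u) = p u" if "u \<in> gverts ?L" for u
      using same[OF diff[OF that]] by (simp add: \<phi>_def)
    moreover have "\<phi> x = y" by (simp add: \<phi>_def symmetry_zero[OF \<sigma>])
    ultimately show ?thesis by (auto simp: deck_transformation_def graph_iso_def)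
  qed
  with cov show ?thesis by (auto simp: normal_covering_map_def)
qed

subsection \<open>Transport of frames\<close>

lemma commuting_int_iterates:
  fixes f :: "'b \<Rightarrow> 'b"
  assumes "bij f"
  obtains P :: "int \<Rightarrow> 'b \<Rightarrow> 'b" where "\<And>k a. P (k + 1) a = f (P k a)" "\<And>a. P 0 a = a"
    "\<And>g k a. g \<circ> f = f \<circ> g \<Longrightarrow> g (P k a) = P k (g a)"
proof -
  \<comment> \<open>Integer powers of \<open>f\<close>, with negative exponents realised by the
    inverse.\<close>
  define P where "P k = (if k \<ge> 0 then f ^^ nat k else inv f ^^ nat (- k))" for k
  have P0: "P 0 a = a" for a by (simp add: P_def)
  have step: "P (k + 1) a = f (P k a)" for k a
  proof (cases "k \<ge> 0")
    case True
    then show ?thesis by (simp add: P_def nat_add_distrib)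
  next
    case False
    then have "nat (- k) = Suc (nat (- (k + 1)))" by simp
    then show ?thesis
      using False assms by (auto simp: P_def bij_is_surj surj_f_inv_f)
  qed
  have "g (P k a) = P k (g a)" if "g \<circ> f = f \<circ> g" for g k a
  proof (induction k rule: int_induct[where k = 0])
    case base
    then show ?case by (simp add: P0)
  next
    case (step1 i)
    then show ?case using that by (metis comp_apply step)
  next
    case (step2 i)
    \<comment> \<open>Going down, \<open>f\<close> is applied to both sides and then cancelled by
      injectivity.\<close>
    then have "f (g (P (i - 1) a)) = f (P (i - 1) (g a))"
      using step[of "i - 1"] that by (metis comp_apply diff_add_cancel)
    then show ?case using assms by (meson bij_is_inj injD)
  qed
  with P0 step show thesis using that by blast
qed

text \<open>The orbit map of \<open>a\<close>, obtained by adding one generator at a time: integer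
  powers of the new bijection commute with the earlier ones.\<close>

lemma commuting_bijections_lattice_action:
  fixes T :: "nat \<Rightarrow> 'b \<Rightarrow> 'b"
  assumes "\<And>i. i < d \<Longrightarrow> bij (T i)" "\<And>i j. i < d \<Longrightarrow> j < d \<Longrightarrow> T i \<circ> T j = T j \<circ> T i"
  shows "\<exists>\<Phi>. \<Phi> 0 = a \<and> (\<forall>x i. i < d \<longrightarrow> \<Phi> (x + unit_vec i) = T i (\<Phi> x))"
  using assms
proof (induction d)
  case 0
  then show ?case by auto
next
  case (Suc d)
  then obtain \<Phi> where \<Phi>: "\<Phi> 0 = a" "\<And>x i. i < d \<Longrightarrow> \<Phi> (x + unit_vec i) = T i (\<Phi> x)"
    by (metis less_Suc_eq)
  obtain P where P: "\<And>k a. P (k + 1) a = T d (P k a)" "\<And>a. P (0::int) a = a"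
    "\<And>g k a. g \<circ> T d = T d \<circ> g \<Longrightarrow> g (P k a) = P k (g a)"
    using commuting_int_iterates[of "T d"] Suc.prems(1) by blast
  \<comment> \<open>The induction hypothesis handles the point with coordinate \<open>d\<close>
    cleared; that coordinate then becomes the exponent of \<open>T d\<close>.\<close>
  define \<Psi> where "\<Psi> x = P (x d) (\<Phi> (x(d := 0)))" for x
  have "\<Psi> (x + unit_vec i) = T i (\<Psi> x)" if "i < Suc d" for x i
  proof (cases "i = d")
    case True
    have "(x + unit_vec d)(d := 0) = x(d := 0)" by (auto simp: unit_vec_def)
    then show ?thesis by (simp add: \<Psi>_def True P(1) unit_vec_def)
  next
    case False
    then have "(x + unit_vec i)(d := 0) = x(d := 0) + unit_vec i" "(x + unit_vec i) d = x d"
      by (auto simp: unit_vec_def)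
    moreover have "T i (P (x d) b) = P (x d) (T i b)" for b
      using P(3) Suc.prems(2)[of i d] that by blast
    ultimately show ?thesis
      using \<Phi>(2) that False by (simp add: \<Psi>_def)
  qed
  moreover have "(0::nat \<Rightarrow> int)(d := 0) = 0" by auto
  then have "\<Psi> 0 = a" using \<Phi>(1) P(2) by (simp add: \<Psi>_def)
  ultimately show ?case by blast
qed

text \<open>Values off the unit ball are set to \<open>undefined\<close> so that equality of frames is equality in HOL.\<close>

definition frame_of :: "nat \<Rightarrow> ((nat \<Rightarrow> int) \<Rightarrow> 'a) \<Rightarrow> (nat \<Rightarrow> int) \<Rightarrow> 'a" where
  "frame_of d h = (\<lambda>u. if u \<in> lball d 1 then h u else undefined)"

lemma frame_of_eq_iff: "frame_of d h = frame_of d g \<longleftrightarrow> (\<forall>u\<in>lball d 1. h u = g u)"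
  by (auto simp: frame_of_def fun_eq_iff simp del: One_nat_def)

text \<open>Radius 2 is taken because moving by a step costs one unit, and a chart of radius 1 must
  remain.\<close>

definition frames :: "nat \<Rightarrow> 'a sgraph \<Rightarrow> ((nat \<Rightarrow> int) \<Rightarrow> 'a) set" where
  "frames d G = frame_of d ` {f. chart d G 2 f}"

text \<open>Off the frames the map is the identity, which makes it a bijection of the whole type, as
  the lattice action requires.\<close>

definition move_frame ::
  "nat \<Rightarrow> 'a sgraph \<Rightarrow> (nat \<Rightarrow> int) \<Rightarrow> ((nat \<Rightarrow> int) \<Rightarrow> 'a) \<Rightarrow> (nat \<Rightarrow> int) \<Rightarrow> 'a" where
  "move_frame d G s F = (if F \<in> frames d G
     then frame_of d (\<lambda>u. (SOME f. chart d G 2 f \<and> frame_of d f = F) (s + u)) else F)"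

lemma lball_1_plus_step: "s \<in> steps d \<Longrightarrow> u \<in> lball d 1 \<Longrightarrow> s + u \<in> lball d 2"
  using add_step_in_lball[of u d 1 s] by (simp add: add.commute numeral_2_eq_2)

text \<open>The chosen extension does not matter: charts with the same frame agree on the ball of
  radius 2, which contains the unit ball moved by \<open>s\<close>.\<close>

lemma move_frame_of:
  assumes f: "chart d G 2 f" and s: "s \<in> steps d"
  shows "move_frame d G s (frame_of d f) = frame_of d (\<lambda>u. f (s + u))"
proof -
  define g where "g = (SOME g. chart d G 2 g \<and> frame_of d g = frame_of d f)"
  have g: "chart d G 2 g" "frame_of d g = frame_of d f"
    unfolding g_def using someI[of "\<lambda>g. chart d G 2 g \<and> frame_of d g = frame_of d f" f] f by auto
  have "g x = f x" if "x \<in> lball d 2" for x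
    using charts_agree_ball_2[OF chart_mono[OF f, of 1] chart_mono[OF g(1), of 1]] that g(2)
    by (simp add: frame_of_eq_iff del: One_nat_def)
  then have "frame_of d (\<lambda>u. g (s + u)) = frame_of d (\<lambda>u. f (s + u))"
    using lball_1_plus_step[OF s] by (simp add: frame_of_eq_iff del: One_nat_def)
  moreover have "frame_of d f \<in> frames d G" using f by (simp add: frames_def)
  ultimately show ?thesis by (simp add: move_frame_def g_def)
qed

context
  fixes d :: nat and G :: "'a sgraph"
  assumes charts: "\<And>v. v \<in> gverts G \<Longrightarrow> \<exists>f. chart d G 2 f \<and> f 0 = v"
begin

text \<open>Some chart of radius 2 exists at \<open>h 0\<close>; precomposing it with a signed
  permutation gives it the frame of \<open>h\<close>.\<close>

lemma chart_extends:
  assumes h: "chart d G 1 h"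
  obtains f where "chart d G 2 f" "frame_of d f = frame_of d h"
proof -
  have "h 0 \<in> gverts G" using h zero_in_lball unfolding chart_def by blast
  then obtain f where f: "chart d G 2 f" "f 0 = h 0" using charts by blast
  obtain \<sigma> where "lattice_symmetry d \<sigma>" "\<And>x. x \<in> lball d 1 \<Longrightarrow> f (\<sigma> x) = h x"
    using charts_differ_by_symmetry[OF h chart_mono[OF f(1)]] f(2) by auto
  then show ?thesis
    using that[OF chart_symmetry[OF _ f(1)]] unfolding frame_of_eq_iff by blast
qed

text \<open>The shifted chart has radius 1 only, so it is first extended to \<open>g\<close>;
  rigidity identifies \<open>g\<close> with the shift of \<open>f\<close> on the ball of radius 2.
  The result depends only on \<open>s + t\<close>, which yields commutation and inverses.\<close>

lemma move_frame_twice: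
  assumes f: "chart d G 2 f" and s: "s \<in> steps d" and t: "t \<in> steps d"
  shows "move_frame d G s (frame_of d f) \<in> frames d G"
    and "move_frame d G t (move_frame d G s (frame_of d f)) = frame_of d (\<lambda>u. f (s + t + u))"
proof -
  have sh: "chart d G 1 (\<lambda>u. f (s + u))"
    using chart_shift[OF _ s] f by (simp add: numeral_2_eq_2)
  then obtain g where g: "chart d G 2 g" "frame_of d g = frame_of d (\<lambda>u. f (s + u))"
    using chart_extends by blast
  then have eq: "move_frame d G s (frame_of d f) = frame_of d g"
    using move_frame_of[OF f s] by simp
  then show "move_frame d G s (frame_of d f) \<in> frames d G"
    using g(1) by (simp add: frames_def)
  have "g x = f (s + x)" if "x \<in> lball d 2" for x
    using charts_agree_ball_2[OF sh chart_mono[OF g(1), of 1]] that g(2)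
    by (simp add: frame_of_eq_iff del: One_nat_def)
  then have "frame_of d (\<lambda>u. g (t + u)) = frame_of d (\<lambda>u. f (s + t + u))"
    using lball_1_plus_step[OF t] by (simp add: frame_of_eq_iff add.assoc del: One_nat_def)
  then show "move_frame d G t (move_frame d G s (frame_of d f)) = frame_of d (\<lambda>u. f (s + t + u))"
    using move_frame_of[OF g(1) t] eq by simp
qed

lemma move_frame_commute:
  assumes "s \<in> steps d" "t \<in> steps d"
  shows "move_frame d G t (move_frame d G s F) = move_frame d G s (move_frame d G t F)"
proof (cases "F \<in> frames d G")
  case True
  then obtain f where "chart d G 2 f" "F = frame_of d f" by (auto simp: frames_def)
  then show ?thesis
    using move_frame_twice(2)[OF _ assms] move_frame_twice(2)[OF _ assms(2,1)]
    by (simp add: add.commute)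
qed (simp add: move_frame_def)

lemma move_frame_uminus:
  assumes "s \<in> steps d"
  shows "move_frame d G (- s) (move_frame d G s F) = F"
proof (cases "F \<in> frames d G")
  case True
  then obtain f where "chart d G 2 f" "F = frame_of d f" by (auto simp: frames_def)
  then show ?thesis
    using move_frame_twice(2)[OF _ assms uminus_in_steps[OF assms]] by simp
qed (simp add: move_frame_def)

lemma move_frame_in_frames:
  assumes "s \<in> steps d" "F \<in> frames d G"
  shows "move_frame d G s F \<in> frames d G"
  using assms move_frame_twice(1)[OF _ assms(1) assms(1)] by (auto simp: frames_def)

lemma developing_exists:
  assumes "gverts G \<noteq> {}"
  shows "\<exists>p. developing d G p"
proof -
  obtain f0 where f0: "chart d G 2 f0" using assms charts by blast
  let ?T = "move_frame d G"
  have "bij (?T (unit_vec i))" if "i < d" for i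
  proof (rule o_bij)
    note s = unit_vec_in_steps[OF that]
    show "?T (- unit_vec i) \<circ> ?T (unit_vec i) = id"
      using move_frame_uminus[OF s] by (simp add: fun_eq_iff)
    show "?T (unit_vec i) \<circ> ?T (- unit_vec i) = id"
      using move_frame_uminus[OF uminus_in_steps[OF s]] by (simp add: fun_eq_iff)
  qed
  moreover have "?T (unit_vec i) \<circ> ?T (unit_vec j) = ?T (unit_vec j) \<circ> ?T (unit_vec i)"
    if "i < d" "j < d" for i j
    using move_frame_commute[OF unit_vec_in_steps[OF that(2)] unit_vec_in_steps[OF that(1)]]
    by (simp add: fun_eq_iff)
  ultimately obtain \<Phi> where \<Phi>0: "\<Phi> 0 = frame_of d f0"
    and \<Phi>: "\<And>x i. i < d \<Longrightarrow> \<Phi> (x + unit_vec i) = ?T (unit_vec i) (\<Phi> x)"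
    using commuting_bijections_lattice_action[of d "\<lambda>i. ?T (unit_vec i)" "frame_of d f0"] by blast
  \<comment> \<open>The action is given for positive unit vectors; negative ones follow by inverting
    a move.\<close>
  have \<Phi>_step: "\<Phi> (x + s) = ?T s (\<Phi> x)" if "s \<in> steps d" for x s
  proof -
    from that obtain i where i: "i < d" "s = unit_vec i \<or> s = - unit_vec i"
      by (auto simp: steps_def)
    have "\<Phi> (x - unit_vec i) = ?T (- unit_vec i) (\<Phi> x)"
      using \<Phi>[OF i(1), of "x - unit_vec i"] move_frame_uminus[OF unit_vec_in_steps[OF i(1)]] by simp
    with i \<Phi>[OF i(1)] show ?thesis by auto
  qed
  have frame: "\<Phi> x \<in> frames d G" if "x \<in> gverts (lattice_graph d)" for x
    using that
  proof (induction x rule: lattice_induct)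
    case zero
    then show ?case using f0 unfolding \<Phi>0 frames_def by blast
  next
    case (step x s)
    show "\<Phi> (x + s) \<in> frames d G"
      unfolding \<Phi>_step[OF step(2)]
      by (rule move_frame_in_frames[OF step(2,3)])
  qed
  \<comment> \<open>The base vertex of the frame transported to \<open>x\<close>.\<close>
  define p where "p x = \<Phi> x 0" for x
  have "chart d G 1 (\<lambda>u. p (x + u))" if x: "x \<in> gverts (lattice_graph d)" for x
  proof -
    obtain f where f: "chart d G 2 f" "\<Phi> x = frame_of d f" using frame[OF x] by (auto simp: frames_def)
    have p1: "p (x + s) = f s" if "s \<in> steps d" for s
      using \<Phi>_step[OF that, of x] move_frame_of[OF f(1) that] zero_in_lball[of d 1] f(2)
      by (simp add: p_def frame_of_def)
    \<comment> \<open>Two moves read off the values of \<open>f\<close> at sums of two steps; with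
      \<open>p1\<close> and the centre this covers the ball of radius 2, all that a chart of radius
      1 sees.\<close>
    have p2: "p (x + (s + t)) = f (s + t)" if "s \<in> steps d" "t \<in> steps d" for s t
      using \<Phi>_step[OF that(2), of "x + s"] \<Phi>_step[OF that(1), of x] move_frame_twice(2)[OF f(1) that]
        zero_in_lball[of d 1] f(2)
      by (simp add: p_def frame_of_def add.assoc)
    have "p x = f 0" using f(2) zero_in_lball[of d 1] by (simp add: p_def frame_of_def)
    with p1 have p01: "p (x + u) = f u" if "u \<in> lball d 1" for u
      using that unfolding lball_1 by auto
    have "p (x + u) = f u" if "u \<in> lball d 2" for u
      using that
    proof (cases rule: lball_2_cases)
      case 1
      then show ?thesis by (rule p01)
    next
      case (2 s t)
      then show ?thesis using p2 by simp
    qed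
    then show ?thesis
      using chart_mono[OF f(1), of 1] chart_cong[of d 1 "\<lambda>u. p (x + u)" f G]
      by (simp add: numeral_2_eq_2)
  qed
  then show ?thesis by (auto simp: developing_def)
qed

end

theorem theorem3:
  fixes d :: nat and G :: "'a sgraph"
  assumes "d \<ge> 3"
    and "simple_graph G"
    and "connected_graph G"
    and "weakly_locally_lattice 3 d G"
  shows "\<exists>p. normal_covering_map p (lattice_graph d) G"
proof -
  have "\<exists>f. chart d G 2 f \<and> f 0 = v" if v: "v \<in> gverts G" for v
  proof -
    \<comment> \<open>The radius 3 is written as \<open>Suc 2\<close>, so that
      \<open>link_iso_chart\<close> yields a chart of radius 2.\<close>
    obtain f where f: "graph_iso f (link_minus (Suc 2) (\<lambda>_. 0) (lattice_graph d)) (link_minus (Suc 2) v G)"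
      "f (\<lambda>_. 0) = v"
      using assms(4) v unfolding weakly_locally_lattice_def by (auto simp: numeral_3_eq_3 numeral_2_eq_2)
    then show ?thesis
      using link_iso_chart[OF v f] by (auto simp: zero_fun_def)
  qed
  moreover have "gverts G \<noteq> {}" using assms(3) by (simp add: connected_graph_def)
  ultimately obtain p where "developing d G p"
    using developing_exists by blast
  then show ?thesis using developing_normal_covering_map by blast
qed

end
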